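(* Let $u,v$ (scalar) and $\mathbf C$ (symmetric $2\times2$-matrix valued) be smooth functions of $(x,y,t)$ on $\{y\ge 0\}\times[0,T)$, let $P(x,t)$ be a given function, and let $x=x(\xi_1,\xi_2,t)$, $y=y(\xi_1,\xi_2,t)$ be the smooth flow map of $\mathbf v=(u,v)$ with deformation gradient $\mathbf F$. Let $\mathbf S=\mathbf F\mathbf C\mathbf F^T$, with entries $S_{ij}$, and suppose that the boundary layer system $$\frac{\partial u}{\partial t}+u\frac{\partial u}{\partial x}+v\frac{\partial u}{\partial y}=\frac{\partial S_{11}}{\partial x}+\frac{\partial S_{12}}{\partial y}-P(x,t),\qquad \frac{\partial \mathbf C}{\partial t}+(\mathbf v\cdot\nabla)\mathbf C=\mathbf 0,\qquad \frac{\partial u}{\partial x}+\frac{\partial v}{\partial y}=0,$$ $$u=v=0\ \text{ at } y=0,\qquad u(x,y,0)=u_0(x,y),\qquad \mathbf C(x,y,0)=\mathbf S_0(x,y)$$ holds. Assume that $\mathbf C$ is positive semidefinite and that there is a constant $C_0>0$ with $C_{22}\ge C_0$. Then, in Lagrangian coordinates, $x(\xi_1,\xi_2,t)$ satisfies the second order hyperbolic equation with initial and boundary conditions $$\frac{\partial^2 x}{\partial t^2}=\nabla\cdot(\mathbf C\nabla x)-P(x,t),\qquad x(\xi_1,\xi_2,0)=\xi_1,\qquad \frac{\partial x}{\partial t}(\xi_1,\xi_2,0)=u_0(\xi_1,\xi_2),\qquad x(\xi_1,0,t)=\xi_1,$$ where $\nabla\cdot(\mathbf C\nabla x)=\sum_{i,j}\frac{\partial}{\partial\xi_i}\Big(C_{ji}(\xi_1,\xi_2)\frac{\partial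 x}{\partial\xi_j}\Big)$, and $\mathbf C(\xi_1,\xi_2)$ denotes $\mathbf C$ expressed in Lagrangian coordinates (which is independent of $t$).
   Context: The flow map is defined for $\xi_1\in\mathbb R$, $\xi_2\ge 0$ by $\partial x/\partial t=u(x,y,t)$, $\partial y/\partial t=v(x,y,t)$, $x(\xi_1,\xi_2,0)=\xi_1$, $y(\xi_1,\xi_2,0)=\xi_2$, and is assumed to exist on $[0,T)$ and to be, for each $t$, a diffeomorphism of the half plane $\{y\ge0\}$. The deformation gradient is $$\mathbf F=\begin{pmatrix}\partial x/\partial\xi_1&\partial x/\partial\xi_2\\ \partial y/\partial\xi_1&\partial y/\partial\xi_2\end{pmatrix}.$$ It is invertible, with $\mathbf F=\mathbf I$ at $t=0$. $\mathbf S$ is the (rescaled) extra stress tensor, related to $\mathbf C$ by $\mathbf C=\mathbf F^{-1}\mathbf S\mathbf F^{-T}$. In the momentum equation, $\mathbf S$ is regarded as a function of the Eulerian variables $(x,y,t)$ by means of the flow map, and $\nabla$ in the equation for $\mathbf C$ is the gradient in $(x,y)$. "In Lagrangian coordinates" means that quantities are evaluated at $(x(\xi_1,\xi_2,t),y(\xi_1,\xi_2,t),t)$ and regarded as functions of $(\xi_1,\xi_2,t)$. In the transformed equation, $\nabla$ denotes the gradient in $(\xi_1,\xi_2)$, and $P(x,t)$ means $P(x(\xi_1,\xi_2,t),t)$. *)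

theory Defs
  imports "HOL-Analysis.Analysis"
begin

text \<open>
  Smoothness up to the boundary: all derivatives are taken within the set. This is meant for sets
  such as \<open>half_plane\<close> and \<open>domain T\<close> below, whose derivatives within the set are unique.
\<close>

fun Ck_on :: "nat \<Rightarrow> 'a::euclidean_space set \<Rightarrow> ('a \<Rightarrow> 'b::real_normed_vector) \<Rightarrow> bool" where
  "Ck_on 0 S f \<longleftrightarrow> continuous_on S f"
| "Ck_on (Suc k) S f \<longleftrightarrow>
     f differentiable_on S \<and> (\<forall>h. Ck_on k S (\<lambda>p. frechet_derivative f (at p within S) h))"

definition smooth_on :: "'a::euclidean_space set \<Rightarrow> ('a \<Rightarrow> 'b::real_normed_vector) \<Rightarrow> bool" where
  "smooth_on S f \<longleftrightarrow> (\<forall>k. Ck_on k S f)"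

definition diffeomorphism_of :: "'a::euclidean_space set \<Rightarrow> ('a \<Rightarrow> 'a) \<Rightarrow> bool" where
  "diffeomorphism_of S f \<longleftrightarrow> bij_betw f S S \<and> smooth_on S f \<and> smooth_on S (inv_into S f)"

definition half_plane :: "(real \<times> real) set" where
  "half_plane = UNIV \<times> {0..}"

definition domain :: "real \<Rightarrow> (real \<times> real \<times> real) set" where
  "domain T = UNIV \<times> {0..} \<times> {0..<T}"

text \<open>
  Partial derivatives of functions on the half plane times \<open>[0,T)\<close>, one-sided at the
  boundary. They serve both for the Eulerian variables \<open>(x, y, t)\<close> and for the Lagrangian
  variables \<open>(\<xi>\<^sub>1, \<xi>\<^sub>2, t)\<close>.
\<close>

definition pderiv_space ::
    "2 \<Rightarrow> (real \<Rightarrow> real \<Rightarrow> real \<Rightarrow> 'b::real_normed_vector) \<Rightarrow> real \<Rightarrow> real \<Rightarrow> real \<Rightarrow> 'b" where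
  "pderiv_space i f a b t =
     (if i = 1 then vector_derivative (\<lambda>s. f s b t) (at a)
      else vector_derivative (\<lambda>s. f a s t) (at b within {0..}))"

definition pderiv_time ::
    "real \<Rightarrow> (real \<Rightarrow> real \<Rightarrow> real \<Rightarrow> 'b::real_normed_vector) \<Rightarrow> real \<Rightarrow> real \<Rightarrow> real \<Rightarrow> 'b" where
  "pderiv_time T f a b t = vector_derivative (\<lambda>s. f a b s) (at t within {0..<T})"

definition is_flow_map ::
    "real \<Rightarrow> (real \<Rightarrow> real \<Rightarrow> real \<Rightarrow> real) \<Rightarrow> (real \<Rightarrow> real \<Rightarrow> real \<Rightarrow> real) \<Rightarrow>
     (real \<Rightarrow> real \<Rightarrow> real \<Rightarrow> real) \<Rightarrow> (real \<Rightarrow> real \<Rightarrow> real \<Rightarrow> real) \<Rightarrow> bool" where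
  "is_flow_map T u v X Y \<longleftrightarrow>
     (\<forall>(\<xi>1, \<xi>2, t) \<in> domain T.
        ((\<lambda>s. X \<xi>1 \<xi>2 s) has_real_derivative u (X \<xi>1 \<xi>2 t) (Y \<xi>1 \<xi>2 t) t) (at t within {0..<T}) \<and>
        ((\<lambda>s. Y \<xi>1 \<xi>2 s) has_real_derivative v (X \<xi>1 \<xi>2 t) (Y \<xi>1 \<xi>2 t) t) (at t within {0..<T})) \<and>
     (\<forall>(\<xi>1, \<xi>2) \<in> half_plane. X \<xi>1 \<xi>2 0 = \<xi>1 \<and> Y \<xi>1 \<xi>2 0 = \<xi>2) \<and>
     (\<forall>t \<in> {0..<T}. diffeomorphism_of half_plane (\<lambda>(\<xi>1, \<xi>2). (X \<xi>1 \<xi>2 t, Y \<xi>1 \<xi>2 t)))"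

definition deformation_gradient ::
    "(real \<Rightarrow> real \<Rightarrow> real \<Rightarrow> real) \<Rightarrow> (real \<Rightarrow> real \<Rightarrow> real \<Rightarrow> real) \<Rightarrow>
     real \<Rightarrow> real \<Rightarrow> real \<Rightarrow> real^2^2" where
  "deformation_gradient X Y \<xi>1 \<xi>2 t =
     (\<chi> i j. pderiv_space j (if i = 1 then X else Y) \<xi>1 \<xi>2 t)"

text \<open>
  The stress \<open>F C F\<^sup>T\<close> as a function of \<open>(x, y, t)\<close>: \<open>F\<close> lives on Lagrangian
  coordinates and is pulled back by the inverse of the flow map at time \<open>t\<close>.
\<close>

definition eulerian_stress ::
    "(real \<Rightarrow> real \<Rightarrow> real \<Rightarrow> real) \<Rightarrow> (real \<Rightarrow> real \<Rightarrow> real \<Rightarrow> real) \<Rightarrow>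
     (real \<Rightarrow> real \<Rightarrow> real \<Rightarrow> real^2^2) \<Rightarrow> real \<Rightarrow> real \<Rightarrow> real \<Rightarrow> real^2^2" where
  "eulerian_stress X Y C x y t =
     (let \<xi> = inv_into half_plane (\<lambda>(\<xi>1, \<xi>2). (X \<xi>1 \<xi>2 t, Y \<xi>1 \<xi>2 t)) (x, y);
          F = deformation_gradient X Y (fst \<xi>) (snd \<xi>) t
      in F ** C x y t ** transpose F)"

definition div_grad ::
    "(real \<Rightarrow> real \<Rightarrow> real^2^2) \<Rightarrow> (real \<Rightarrow> real \<Rightarrow> real \<Rightarrow> real) \<Rightarrow>
     real \<Rightarrow> real \<Rightarrow> real \<Rightarrow> real" where
  "div_grad A w \<xi>1 \<xi>2 t =
     (\<Sum>i\<in>UNIV. \<Sum>j\<in>UNIV. pderiv_space i (\<lambda>a b s. A a b $ j $ i * pderiv_space j w a b s) \<xi>1 \<xi>2 t)"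

text \<open>
  Hyperbolicity in the time direction, at a point with coefficient matrix \<open>A\<close>, of an equation with
  principal part \<open>\<partial>\<^sub>t\<^sup>2 - (\<Sum>i j. A\<^sub>j\<^sub>i \<partial>\<^sub>i \<partial>\<^sub>j)\<close>: for real \<open>\<eta>\<close>, the principal symbol has only real
  roots \<open>\<tau>\<close>. Double roots are allowed, as \<open>A\<close> may be degenerate.
\<close>

definition hyperbolic_in_time :: "real^2^2 \<Rightarrow> bool" where
  "hyperbolic_in_time A \<longleftrightarrow>
     (\<forall>(\<eta>::real^2) (\<tau>::complex). \<tau>\<^sup>2 - complex_of_real (\<eta> \<bullet> (A *v \<eta>)) = 0 \<longrightarrow> \<tau> \<in> \<real>)"

end

theory Submission
  imports Defs
begin

text \<open>
  The transport equation says that \<open>C\<close> is constant along trajectories, so in Lagrangian coordinates it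
  is its initial value. Differentiating \<open>x\<^sub>t = u(x, y, t)\<close> in time gives the left-hand side
  of the momentum equation. The divergence of \<open>S = F C F\<^sup>T\<close> turns into that of \<open>C \<nabla>x\<close> by the Piola
  identity: incompressibility and Liouville's formula give \<open>det F = 1\<close>, and the terms containing second
  derivatives of the flow combine to derivatives of \<open>det F\<close>, which vanish. At the wall, \<open>v \<le> L y\<close> and
  Gronwall's inequality keep \<open>y = 0\<close>, whence \<open>x\<close> is constant by the no-slip condition.
\<close>

subsection \<open>Smoothness within a set\<close>

text \<open>Everything must hold at the wall and at the initial time, so all calculus is one-sided:
  \<open>domain T\<close> is a product of intervals, and along each coordinate direction the
  derivative within it reduces to a derivative within one interval. The stress is a second obstacle:
  as an Eulerian field it is given through the inverse of the flow map, so its derivatives in x and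
  y are reached by the chain rule with that inverse at a frozen time. The wave operator appears
  because the rows of F are the gradients of x and y, so that the first row of
  \<open>F C F^T\<close> is F applied to the vector G = C grad x. When det F = 1, G is therefore the
  Piola transform of (S11, S12), and the Eulerian divergence in the momentum equation equals the
  Lagrangian divergence of G.\<close>

lemma has_derivative_within_cong:
  assumes "p \<in> S" "\<And>q. q \<in> S \<Longrightarrow> f q = g q"
  shows "(f has_derivative f') (at p within S) \<longleftrightarrow> (g has_derivative f') (at p within S)"
  using has_derivative_transform[OF assms(1), of f g f'] has_derivative_transform[OF assms(1), of g f f']
    assms(2) by metis

text \<open>\<open>frechet_derivative\<close> is a choice among all derivatives. Both functions have
  the same set of candidates, so the choices coincide without any appeal to uniqueness within
  S.\<close>

lemma frechet_derivative_within_cong: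
  assumes "p \<in> S" "\<And>q. q \<in> S \<Longrightarrow> f q = g q"
  shows "frechet_derivative f (at p within S) = frechet_derivative g (at p within S)"
  unfolding frechet_derivative_def using has_derivative_within_cong[of p S f g, OF assms] by simp

lemma Ck_on_cong:
  assumes "\<And>q. q \<in> S \<Longrightarrow> f q = g q"
  shows "Ck_on k S f \<longleftrightarrow> Ck_on k S g"
  using assms
proof (induction k arbitrary: f g)
  case 0
  then show ?case
    by (simp cong: continuous_on_cong)
next
  case (Suc k)
  have "f differentiable_on S \<longleftrightarrow> g differentiable_on S"
    unfolding differentiable_on_def differentiable_def
    using has_derivative_within_cong[of _ S f g, OF _ Suc.prems] by simp
  moreover have "Ck_on k S (\<lambda>p. frechet_derivative f (at p within S) h)
      \<longleftrightarrow> Ck_on k S (\<lambda>p. frechet_derivative g (at p within S) h)" for h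
    by (rule Suc.IH) (simp add: frechet_derivative_within_cong[of _ S f g, OF _ Suc.prems])
  ultimately show ?case
    by simp
qed

lemma smooth_on_cong:
  assumes "\<And>q. q \<in> S \<Longrightarrow> f q = g q"
  shows "smooth_on S f \<longleftrightarrow> smooth_on S g"
  unfolding smooth_on_def using Ck_on_cong[of S f g, OF assms] by simp

lemma smooth_on_frechet_derivative:
  "smooth_on S f \<Longrightarrow> smooth_on S (\<lambda>p. frechet_derivative f (at p within S) h)"
  unfolding smooth_on_def by (metis Ck_on.simps(2))

lemma smooth_on_differentiable_on: "smooth_on S f \<Longrightarrow> f differentiable_on S"
  unfolding smooth_on_def by (metis Ck_on.simps(2))

lemma smooth_on_continuous_on: "smooth_on S f \<Longrightarrow> continuous_on S f"
  unfolding smooth_on_def by (metis Ck_on.simps(1))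

lemma smooth_on_has_derivative:
  "smooth_on S f \<Longrightarrow> p \<in> S \<Longrightarrow>
    (f has_derivative frechet_derivative f (at p within S)) (at p within S)"
  using smooth_on_differentiable_on[of S f]
  by (simp add: differentiable_on_def frechet_derivative_works[symmetric])

text \<open>The curve has to stay in S only for parameters in I. One-sided partial derivatives at
  the boundary are thus covered by choosing I as a half-line or an interval.\<close>

lemma has_vector_derivative_along_line:
  assumes "(f has_derivative f') (at p within S)" "\<gamma> s0 = p" "\<And>s. s \<in> I \<Longrightarrow> \<gamma> s \<in> S"
    and "(\<gamma> has_vector_derivative h) (at s0 within I)"
  shows "((\<lambda>s. f (\<gamma> s)) has_vector_derivative f' h) (at s0 within I)"
proof -
  have "((\<lambda>s. f (\<gamma> s)) has_derivative (\<lambda>s. f' (s *\<^sub>R h))) (at s0 within I)"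
  proof (rule has_derivative_in_compose[of \<gamma> "\<lambda>s. s *\<^sub>R h" s0 I f f'])
    show "(\<gamma> has_derivative (\<lambda>s. s *\<^sub>R h)) (at s0 within I)"
      using assms(4) by (simp add: has_vector_derivative_def)
    show "(f has_derivative f') (at (\<gamma> s0) within \<gamma> ` I)"
      using assms(1-3) by (auto intro: has_derivative_subset)
  qed
  then show ?thesis
    by (simp add: has_vector_derivative_def linear_scale[OF has_derivative_linear[OF assms(1)]])
qed

subsection \<open>Partial derivatives on the domain\<close>

lemma mem_domain [simp]: "(a, b, t) \<in> domain T \<longleftrightarrow> 0 \<le> b \<and> 0 \<le> t \<and> t < T"
  by (auto simp: domain_def)

lemma mem_half_plane [simp]: "(a, b) \<in> half_plane \<longleftrightarrow> 0 \<le> b"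
  by (auto simp: half_plane_def)

text \<open>Nontriviality of the filter makes the one-sided \<open>vector_derivative\<close> unique,
  even at the endpoint 0.\<close>

lemma at_within_atLeast_neq_bot: "(b::real) \<ge> 0 \<Longrightarrow> at b within {0..} \<noteq> bot"
  using islimpt_Icc[of b "b+1" b] islimpt_subset[of b "{b..b+1}" "{0..}"]
  by (auto simp: trivial_limit_within)

lemma at_within_atLeastLessThan_neq_bot:
  assumes "t \<in> {0..<T::real}"
  shows "at t within {0..<T} \<noteq> bot"
proof -
  have "t islimpt {t..(t+T)/2}"
    using assms by (simp add: islimpt_Icc)
  then have "t islimpt {0..<T}"
    by (rule islimpt_subset) (use assms in auto)
  then show ?thesis
    by (simp add: trivial_limit_within)
qed

lemma pderiv_space_1_eq:
  "((\<lambda>s. f s b t) has_vector_derivative f') (at a) \<Longrightarrow> pderiv_space 1 f a b t = f'"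
  by (simp add: pderiv_space_def vector_derivative_at)

lemma pderiv_space_2_eq:
  "((\<lambda>s. f a s t) has_vector_derivative f') (at b within {0..}) \<Longrightarrow> 0 \<le> b
    \<Longrightarrow> pderiv_space 2 f a b t = f'"
  by (simp add: pderiv_space_def vector_derivative_within at_within_atLeast_neq_bot)

lemma pderiv_time_eq:
  "((\<lambda>s. f a b s) has_vector_derivative f') (at t within {0..<T}) \<Longrightarrow> 0 \<le> t \<Longrightarrow> t < T
    \<Longrightarrow> pderiv_time T f a b t = f'"
  by (simp add: pderiv_time_def vector_derivative_within at_within_atLeastLessThan_neq_bot)

text \<open>Since \<open>domain T\<close> is a product, each axis-parallel line through the point
  meets it exactly in the set within which the corresponding partial derivative is taken. The
  derivative f' is arbitrary, so its values on the basis vectors are forced.\<close>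

lemma pderiv_frechet:
  assumes "((\<lambda>(x, y, t). f x y t) has_derivative f') (at (a, b, t) within domain T)"
    and "(a, b, t) \<in> domain T"
  shows "pderiv_space 1 f a b t = f' (1, 0, 0)"
    and "pderiv_space 2 f a b t = f' (0, 1, 0)"
    and "pderiv_time T f a b t = f' (0, 0, 1)"
proof -
  show "pderiv_space 1 f a b t = f' (1, 0, 0)"
    by (rule pderiv_space_1_eq,
        rule has_vector_derivative_along_line[OF assms(1), where \<gamma> = "\<lambda>s. (s, b, t)", simplified])
       (use assms(2) in \<open>auto intro!: derivative_eq_intros simp: zero_prod_def\<close>)
  show "pderiv_space 2 f a b t = f' (0, 1, 0)"
    by (rule pderiv_space_2_eq,
        rule has_vector_derivative_along_line[OF assms(1), where \<gamma> = "\<lambda>s. (a, s, t)", simplified])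
       (use assms(2) in \<open>auto intro!: derivative_eq_intros simp: zero_prod_def\<close>)
  show "pderiv_time T f a b t = f' (0, 0, 1)"
    by (rule pderiv_time_eq,
        rule has_vector_derivative_along_line[OF assms(1), where \<gamma> = "\<lambda>s. (a, b, s)", simplified])
       (use assms(2) in \<open>auto intro!: derivative_eq_intros simp: zero_prod_def\<close>)
qed

lemma smooth_on_pderiv:
  assumes "smooth_on (domain T) (\<lambda>(x, y, t). f x y t)"
  shows "smooth_on (domain T) (\<lambda>(x, y, t). pderiv_space i f x y t)"
    and "smooth_on (domain T) (\<lambda>(x, y, t). pderiv_time T f x y t)"
proof -
  let ?D = "\<lambda>p. frechet_derivative (\<lambda>(x, y, t). f x y t) (at p within domain T)"
  have D: "((\<lambda>(x, y, t). f x y t) has_derivative ?D p) (at p within domain T)"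
    if "p \<in> domain T" for p
    using smooth_on_has_derivative[OF assms that] .
  note partials = pderiv_frechet[OF D]
  have "smooth_on (domain T) (\<lambda>p. ?D p (if i = 1 then (1, 0, 0) else (0, 1, 0)))"
    by (rule smooth_on_frechet_derivative[OF assms])
  also have "?this \<longleftrightarrow> smooth_on (domain T) (\<lambda>(x, y, t). pderiv_space i f x y t)"
  proof (rule smooth_on_cong, clarify)
    fix a b t assume "(a, b, t) \<in> domain T"
    from partials(1,2)[OF this this] exhaust_2[of i]
    show "?D (a, b, t) (if i = 1 then (1, 0, 0) else (0, 1, 0)) = pderiv_space i f a b t"
      by auto
  qed
  finally show "smooth_on (domain T) (\<lambda>(x, y, t). pderiv_space i f x y t)" .
  have "smooth_on (domain T) (\<lambda>p. ?D p (0, 0, 1))"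
    by (rule smooth_on_frechet_derivative[OF assms])
  also have "?this \<longleftrightarrow> smooth_on (domain T) (\<lambda>(x, y, t). pderiv_time T f x y t)"
  proof (rule smooth_on_cong, clarify)
    fix a b t assume "(a, b, t) \<in> domain T"
    from partials(3)[OF this this]
    show "?D (a, b, t) (0, 0, 1) = pderiv_time T f a b t"
      by (rule sym)
  qed
  finally show "smooth_on (domain T) (\<lambda>(x, y, t). pderiv_time T f x y t)" .
qed

text \<open>A linear map is determined by its values on the basis. This replaces the chosen Frechet
  derivative by explicit partials, as the chain rules below require.\<close>

lemma smooth_on_domain_has_derivative:
  assumes "smooth_on (domain T) (\<lambda>(x, y, t). f x y t)" and "(a, b, t) \<in> domain T"
  shows "((\<lambda>(x, y, t). f x y t) has_derivative
    (\<lambda>(h, k, l). h *\<^sub>R pderiv_space 1 f a b t + k *\<^sub>R pderiv_space 2 f a b t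
      + l *\<^sub>R pderiv_time T f a b t)) (at (a, b, t) within domain T)"
proof -
  let ?D = "frechet_derivative (\<lambda>(x, y, t). f x y t) (at (a, b, t) within domain T)"
  have D: "((\<lambda>(x, y, t). f x y t) has_derivative ?D) (at (a, b, t) within domain T)"
    using smooth_on_has_derivative[OF assms] .
  then have "linear ?D"
    using has_derivative_linear by blast
  have "?D q = (\<lambda>(h, k, l). h *\<^sub>R pderiv_space 1 f a b t + k *\<^sub>R pderiv_space 2 f a b t
      + l *\<^sub>R pderiv_time T f a b t) q" for q
  proof -
    obtain h k l where q: "q = (h, k, l)"
      using prod_cases3 by blast
    have "?D (h, k, l) = ?D (h *\<^sub>R (1, 0, 0) + k *\<^sub>R (0, 1, 0) + l *\<^sub>R (0, 0, 1))"
      by simp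
    also have "\<dots> = h *\<^sub>R ?D (1, 0, 0) + k *\<^sub>R ?D (0, 1, 0) + l *\<^sub>R ?D (0, 0, 1)"
      by (simp only: linear_add[OF \<open>linear ?D\<close>] linear_scale[OF \<open>linear ?D\<close>])
    finally show ?thesis
      unfolding q pderiv_frechet[OF D assms(2)] prod.case .
  qed
  then show ?thesis
    by (rule has_derivative_eq_rhs[OF D ext])
qed

lemma has_vector_derivative_along_path:
  assumes "smooth_on (domain T) (\<lambda>(x, y, t). f x y t)"
    and "(x has_real_derivative x') (at s within I)"
    and "(y has_real_derivative y') (at s within I)"
    and "(\<tau> has_real_derivative \<tau>') (at s within I)"
    and "\<And>r. r \<in> I \<Longrightarrow> (x r, y r, \<tau> r) \<in> domain T" and "s \<in> I"
  shows "((\<lambda>s. f (x s) (y s) (\<tau> s)) has_vector_derivative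
    (x' *\<^sub>R pderiv_space 1 f (x s) (y s) (\<tau> s) + y' *\<^sub>R pderiv_space 2 f (x s) (y s) (\<tau> s)
      + \<tau>' *\<^sub>R pderiv_time T f (x s) (y s) (\<tau> s))) (at s within I)"
proof -
  have "((\<lambda>s. (x s, y s, \<tau> s)) has_vector_derivative (x', y', \<tau>')) (at s within I)"
    using assms(2-4)
    by (intro has_vector_derivative_Pair)
       (simp_all add: has_real_derivative_iff_has_vector_derivative)
  from has_vector_derivative_along_line[OF
      smooth_on_domain_has_derivative[OF assms(1) assms(5)[OF assms(6)]] refl assms(5) this]
  show ?thesis
    by simp
qed

text \<open>The free interval I allows restriction to compact subintervals, which the mean value
  theorem needs.\<close>

lemma smooth_on_slices:
  assumes "smooth_on (domain T) (\<lambda>(x, y, t). f x y t)" and "(a, b, t) \<in> domain T"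
  shows "((\<lambda>s. f s b t) has_vector_derivative pderiv_space 1 f a b t) (at a within I)"
    and "I \<subseteq> {0..} \<Longrightarrow> b \<in> I \<Longrightarrow>
      ((\<lambda>s. f a s t) has_vector_derivative pderiv_space 2 f a b t) (at b within I)"
    and "I \<subseteq> {0..<T} \<Longrightarrow> t \<in> I \<Longrightarrow>
      ((\<lambda>s. f a b s) has_vector_derivative pderiv_time T f a b t) (at t within I)"
proof -
  have "((\<lambda>s. f s b t) has_vector_derivative pderiv_space 1 f a b t) (at a within UNIV)"
    using has_vector_derivative_along_path[OF assms(1),
        of "\<lambda>s. s" 1 a UNIV "\<lambda>_. b" 0 "\<lambda>_. t" 0] assms(2) by auto
  then show "((\<lambda>s. f s b t) has_vector_derivative pderiv_space 1 f a b t) (at a within I)"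
    using has_vector_derivative_within_subset by blast
  show "((\<lambda>s. f a s t) has_vector_derivative pderiv_space 2 f a b t) (at b within I)"
    if "I \<subseteq> {0..}" "b \<in> I"
    using has_vector_derivative_along_path[OF assms(1),
        of "\<lambda>_. a" 0 b I "\<lambda>s. s" 1 "\<lambda>_. t" 0] assms(2) that by auto
  show "((\<lambda>s. f a b s) has_vector_derivative pderiv_time T f a b t) (at t within I)"
    if "I \<subseteq> {0..<T}" "t \<in> I"
    using has_vector_derivative_along_path[OF assms(1),
        of "\<lambda>_. a" 0 t I "\<lambda>_. b" 0 "\<lambda>s. s" 1] assms(2) that by (auto simp: subset_iff)
qed

subsection \<open>Symmetry of second derivatives\<close>

lemma mvt_real:
  fixes f f' :: "real \<Rightarrow> real"
  assumes "a < b"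
    and "\<And>x. x \<in> {a..b} \<Longrightarrow> (f has_real_derivative f' x) (at x within {a..b})"
  obtains c where "a < c" "c < b" "f b - f a = f' c * (b - a)"
  using mvt_simple[OF assms(1), of f "\<lambda>x. (*) (f' x)"] assms(2)
  by (auto simp: has_field_derivative_def)

text \<open>The point is the corner of the rectangle, so that this applies on the boundary of the domain.\<close>

lemma mixed_partials_eq:
  fixes f fs ft fst' fts' :: "real \<Rightarrow> real \<Rightarrow> real"
  assumes "0 < e" and R: "R = {a..a+e} \<times> {b..b+e}"
    and fs: "\<And>s t. (s, t) \<in> R \<Longrightarrow> ((\<lambda>s. f s t) has_real_derivative fs s t) (at s within {a..a+e})"
    and ft: "\<And>s t. (s, t) \<in> R \<Longrightarrow> ((\<lambda>t. f s t) has_real_derivative ft s t) (at t within {b..b+e})"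
    and fst: "\<And>s t. (s, t) \<in> R \<Longrightarrow> ((\<lambda>t. fs s t) has_real_derivative fst' s t) (at t within {b..b+e})"
    and fts: "\<And>s t. (s, t) \<in> R \<Longrightarrow> ((\<lambda>s. ft s t) has_real_derivative fts' s t) (at s within {a..a+e})"
    and cst: "continuous_on R (\<lambda>p. fst' (fst p) (snd p))" and cts: "continuous_on R (\<lambda>p. fts' (fst p) (snd p))"
  shows "fst' a b = fts' a b"
proof (rule ccontr)
  assume neq: "fst' a b \<noteq> fts' a b"
  \<comment> \<open>Half of the gap: a common value closer than this to both mixed derivatives at
    the corner would contradict the triangle inequality.\<close>
  define \<epsilon> where "\<epsilon> = \<bar>fst' a b - fts' a b\<bar> / 2"
  have "\<epsilon> > 0"
    using neq by (simp add: \<epsilon>_def)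
  have corner: "(a, b) \<in> R"
    using \<open>0 < e\<close> by (simp add: R)
  obtain d1 where d1: "d1 > 0" "\<And>s t. (s, t) \<in> R \<Longrightarrow> dist (s, t) (a, b) < d1
      \<Longrightarrow> dist (fst' s t) (fst' a b) < \<epsilon>"
    using cst corner \<open>\<epsilon> > 0\<close> unfolding continuous_on_iff by fastforce
  obtain d2 where d2: "d2 > 0" "\<And>s t. (s, t) \<in> R \<Longrightarrow> dist (s, t) (a, b) < d2
      \<Longrightarrow> dist (fts' s t) (fts' a b) < \<epsilon>"
    using cts corner \<open>\<epsilon> > 0\<close> unfolding continuous_on_iff by fastforce
  \<comment> \<open>A point of the square of side d has distance less than 2 d from the corner,
    hence less than d1 and d2 because of the factor 1/3.\<close>
  define d where "d = min e (min d1 d2 / 3)"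
  have d: "0 < d" "d \<le> e" "d \<le> d1 / 3" "d \<le> d2 / 3"
    using \<open>0 < e\<close> d1(1) d2(1) by (auto simp: d_def)
  have near: "(s, t) \<in> R \<and> dist (s, t) (a, b) < d1 \<and> dist (s, t) (a, b) < d2"
    if "a < s" "s < a + d" "b < t" "t < b + d" for s t
  proof -
    have "dist (s, t) (a, b) \<le> \<bar>s - a\<bar> + \<bar>t - b\<bar>"
      by (simp add: dist_prod_def dist_real_def sqrt_sum_squares_le_sum_abs)
    then show ?thesis
      using that d by (auto simp: R)
  qed
  have mem: "(s, t) \<in> R" if "s \<in> {a..a+d}" "t \<in> {b..b+d}" for s t
    using that d by (auto simp: R)
  have sub: "{a..a+d} \<subseteq> {a..a+e}" "{b..b+d} \<subseteq> {b..b+e}"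
    using d by auto
  note ders = DERIV_subset[OF fs sub(1)] DERIV_subset[OF ft sub(2)]
    DERIV_subset[OF fst sub(2)] DERIV_subset[OF fts sub(1)]
  \<comment> \<open>The second difference of f over the square is evaluated by two mean values,
    first in s and then in t, and below in the opposite order. Each order produces one of the mixed
    derivatives at an interior point.\<close>
  obtain \<sigma> where \<sigma>: "a < \<sigma>" "\<sigma> < a + d"
    "(f (a+d) (b+d) - f (a+d) b) - (f a (b+d) - f a b) = (fs \<sigma> (b+d) - fs \<sigma> b) * (a + d - a)"
    by (rule mvt_real[of a "a+d" "\<lambda>s. f s (b+d) - f s b" "\<lambda>s. fs s (b+d) - fs s b"])
       (use d in \<open>auto intro!: DERIV_diff ders mem\<close>)
  obtain \<tau> where \<tau>: "b < \<tau>" "\<tau> < b + d" "fs \<sigma> (b+d) - fs \<sigma> b = fst' \<sigma> \<tau> * (b + d - b)"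
    by (rule mvt_real[of b "b+d" "fs \<sigma>" "fst' \<sigma>"])
       (use d \<sigma> in \<open>auto intro!: ders mem\<close>)
  obtain \<tau>' where \<tau>': "b < \<tau>'" "\<tau>' < b + d"
    "(f (a+d) (b+d) - f a (b+d)) - (f (a+d) b - f a b) = (ft (a+d) \<tau>' - ft a \<tau>') * (b + d - b)"
    by (rule mvt_real[of b "b+d" "\<lambda>t. f (a+d) t - f a t" "\<lambda>t. ft (a+d) t - ft a t"])
       (use d in \<open>auto intro!: DERIV_diff ders mem\<close>)
  obtain \<sigma>' where \<sigma>': "a < \<sigma>'" "\<sigma>' < a + d" "ft (a+d) \<tau>' - ft a \<tau>' = fts' \<sigma>' \<tau>' * (a + d - a)"
    by (rule mvt_real[of a "a+d" "\<lambda>s. ft s \<tau>'" "\<lambda>s. fts' s \<tau>'"])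
       (use d \<tau>' in \<open>auto intro!: ders mem\<close>)
  have "fst' \<sigma> \<tau> * d * d = fts' \<sigma>' \<tau>' * d * d"
    using \<sigma>(3)[unfolded \<tau>(3)] \<tau>'(3)[unfolded \<sigma>'(3)] by (simp only: add_diff_cancel_left')
  then have "fst' \<sigma> \<tau> = fts' \<sigma>' \<tau>'"
    using d by simp
  moreover have "dist (fst' \<sigma> \<tau>) (fst' a b) < \<epsilon>" "dist (fts' \<sigma>' \<tau>') (fts' a b) < \<epsilon>"
    using near \<sigma>(1,2) \<tau>(1,2) \<sigma>'(1,2) \<tau>'(1,2) d1(2) d2(2) by blast+
  ultimately show False
    by (auto simp: \<epsilon>_def dist_real_def abs_if split: if_splits)
qed

lemma smooth_on_domain_continuous_on_compose:
  assumes "smooth_on (domain T) (\<lambda>(x, y, t). f x y t)"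
    and "continuous_on R x" "continuous_on R y" "continuous_on R \<tau>"
    and "\<And>p. p \<in> R \<Longrightarrow> (x p, y p, \<tau> p) \<in> domain T"
  shows "continuous_on R (\<lambda>p. f (x p) (y p) (\<tau> p))"
proof -
  have "continuous_on R (\<lambda>p. (\<lambda>(x, y, t). f x y t) (x p, y p, \<tau> p))"
    by (rule continuous_on_compose2[OF smooth_on_continuous_on[OF assms(1)]])
       (use assms(2-5) in \<open>auto intro!: continuous_on_Pair\<close>)
  then show ?thesis
    by simp
qed

lemma pderiv_commute:
  fixes f :: "real \<Rightarrow> real \<Rightarrow> real \<Rightarrow> real"
  assumes f: "smooth_on (domain T) (\<lambda>(x, y, t). f x y t)" and p: "(a, b, t) \<in> domain T"
  shows "pderiv_space 2 (pderiv_space 1 f) a b t = pderiv_space 1 (pderiv_space 2 f) a b t"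
    and "pderiv_time T (pderiv_space i f) a b t = pderiv_space i (pderiv_time T f) a b t"
proof -
  note S = smooth_on_slices[where ?'a = real, folded has_real_derivative_iff_has_vector_derivative]
  note fS = smooth_on_pderiv(1)[OF f] and fT = smooth_on_pderiv(2)[OF f]
  note cont = smooth_on_domain_continuous_on_compose
  \<comment> \<open>Half of the remaining time keeps the rectangle before T. It extends only towards
    larger coordinates, so b = 0 and t = 0 are admissible corners.\<close>
  define e where "e = (T - t) / 2"
  have e: "0 < e" "t + e < T"
    using p by (auto simp: e_def field_simps)
  show "pderiv_space 2 (pderiv_space 1 f) a b t = pderiv_space 1 (pderiv_space 2 f) a b t"
    by (rule mixed_partials_eq[OF e(1) refl, where f = "\<lambda>r s. f r s t" and a = a and b = b
        and fs = "\<lambda>r s. pderiv_space 1 f r s t" and ft = "\<lambda>r s. pderiv_space 2 f r s t"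
        and fst' = "\<lambda>r s. pderiv_space 2 (pderiv_space 1 f) r s t"
        and fts' = "\<lambda>r s. pderiv_space 1 (pderiv_space 2 f) r s t"];
       (rule S(1)[OF f] S(2)[OF f] S(2)[OF fS] S(1)[OF fS]
        cont[OF smooth_on_pderiv(1)[OF fS]])?)
       (use p e in \<open>auto intro!: continuous_intros\<close>)
  have "pderiv_time T (pderiv_space 1 f) a b t = pderiv_space 1 (pderiv_time T f) a b t"
    by (rule mixed_partials_eq[OF e(1) refl, where f = "\<lambda>r s. f r b s" and a = a and b = t
        and fs = "\<lambda>r s. pderiv_space 1 f r b s" and ft = "\<lambda>r s. pderiv_time T f r b s"
        and fst' = "\<lambda>r s. pderiv_time T (pderiv_space 1 f) r b s"
        and fts' = "\<lambda>r s. pderiv_space 1 (pderiv_time T f) r b s"];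
       (rule S(1)[OF f] S(3)[OF f] S(3)[OF fS] S(1)[OF fT]
        cont[OF smooth_on_pderiv(2)[OF fS]] cont[OF smooth_on_pderiv(1)[OF fT]])?)
       (use p e in \<open>auto intro!: continuous_intros\<close>)
  moreover
  have "pderiv_time T (pderiv_space 2 f) a b t = pderiv_space 2 (pderiv_time T f) a b t"
    by (rule mixed_partials_eq[OF e(1) refl, where f = "\<lambda>r s. f a r s" and a = b and b = t
        and fs = "\<lambda>r s. pderiv_space 2 f a r s" and ft = "\<lambda>r s. pderiv_time T f a r s"
        and fst' = "\<lambda>r s. pderiv_time T (pderiv_space 2 f) a r s"
        and fts' = "\<lambda>r s. pderiv_space 2 (pderiv_time T f) a r s"];
       (rule S(2)[OF f] S(3)[OF f] S(3)[OF fS] S(2)[OF fT]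
        cont[OF smooth_on_pderiv(2)[OF fS]] cont[OF smooth_on_pderiv(1)[OF fT]])?)
       (use p e in \<open>auto intro!: continuous_intros\<close>)
  ultimately show "pderiv_time T (pderiv_space i f) a b t = pderiv_space i (pderiv_time T f) a b t"
    using exhaust_2[of i] by auto
qed

subsection \<open>Fixed time\<close>

lemma half_plane_slices:
  assumes "((\<lambda>(x, y). f x y t) has_derivative f') (at (a, b) within half_plane)" "0 \<le> b"
  shows "((\<lambda>s. f s b t) has_vector_derivative f' (1, 0)) (at a)"
    and "((\<lambda>s. f a s t) has_vector_derivative f' (0, 1)) (at b within {0..})"
proof -
  show "((\<lambda>s. f s b t) has_vector_derivative f' (1, 0)) (at a)"
    by (rule has_vector_derivative_along_line[OF assms(1), where \<gamma> = "\<lambda>s. (s, b)", simplified])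
       (use assms(2) in \<open>auto intro!: derivative_eq_intros simp: zero_prod_def\<close>)
  show "((\<lambda>s. f a s t) has_vector_derivative f' (0, 1)) (at b within {0..})"
    by (rule has_vector_derivative_along_line[OF assms(1), where \<gamma> = "\<lambda>s. (a, s)", simplified])
       (use assms(2) in \<open>auto intro!: derivative_eq_intros simp: zero_prod_def\<close>)
qed

lemma half_plane_pderiv:
  assumes "((\<lambda>(x, y). f x y t) has_derivative f') (at (a, b) within half_plane)" "0 \<le> b"
  shows "pderiv_space 1 f a b t = f' (1, 0)" and "pderiv_space 2 f a b t = f' (0, 1)"
  using half_plane_slices[of f t f' a b, OF assms] assms(2) by (simp_all add: pderiv_space_1_eq pderiv_space_2_eq)

text \<open>Differentiability at one frozen time suffices for the sum and product rules in space. It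
  is closed under sums and products directly, whereas \<open>smooth_on\<close> would call for an
  induction over the order.\<close>

definition slice_differentiable ::
    "(real \<Rightarrow> real \<Rightarrow> real \<Rightarrow> 'b::real_normed_vector) \<Rightarrow> real \<Rightarrow> bool" where
  "slice_differentiable f t \<longleftrightarrow> (\<lambda>(x, y). f x y t) differentiable_on half_plane"

lemma slice_differentiable_slices:
  assumes "slice_differentiable f t" "0 \<le> b"
  shows "((\<lambda>s. f s b t) has_vector_derivative pderiv_space 1 f a b t) (at a)"
    and "((\<lambda>s. f a s t) has_vector_derivative pderiv_space 2 f a b t) (at b within {0..})"
proof -
  obtain f' where f': "((\<lambda>(x, y). f x y t) has_derivative f') (at (a, b) within half_plane)"
    using assms unfolding slice_differentiable_def differentiable_on_def differentiable_def by fastforce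
  show "((\<lambda>s. f s b t) has_vector_derivative pderiv_space 1 f a b t) (at a)"
    and "((\<lambda>s. f a s t) has_vector_derivative pderiv_space 2 f a b t) (at b within {0..})"
    using half_plane_slices[of f t f' a b, OF f' assms(2)] by (simp_all add: half_plane_pderiv[of f t f' a b, OF f' assms(2)])
qed

lemma smooth_on_domain_slice_differentiable:
  assumes "smooth_on (domain T) (\<lambda>(x, y, t). f x y t)" "0 \<le> t" "t < T"
  shows "slice_differentiable f t"
proof -
  have "(\<lambda>p. (\<lambda>(x, y, t). f x y t) (fst p, snd p, t)) differentiable (at p within half_plane)"
    if p: "p \<in> half_plane" for p
  proof -
    obtain f' where f': "((\<lambda>(x, y, t). f x y t) has_derivative f') (at (fst p, snd p, t) within domain T)"
      using smooth_on_has_derivative[OF assms(1), of "(fst p, snd p, t)"] p assms(2,3) by (cases p) auto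
    have "((\<lambda>p. (fst p, snd p, t)) has_derivative (\<lambda>h. (fst h, snd h, 0))) (at p within half_plane)"
      by (auto intro!: derivative_eq_intros)
    then have "((\<lambda>p. (\<lambda>(x, y, t). f x y t) (fst p, snd p, t)) has_derivative (\<lambda>h. f' (fst h, snd h, 0)))
        (at p within half_plane)"
      by (rule has_derivative_in_compose)
         (rule has_derivative_subset[OF f'], use assms(2,3) in \<open>auto simp: half_plane_def\<close>)
    then show ?thesis
      by (auto simp: differentiable_def)
  qed
  then show ?thesis
    by (simp add: slice_differentiable_def differentiable_on_def case_prod_unfold)
qed

lemma slice_differentiable_mult:
  fixes f g :: "real \<Rightarrow> real \<Rightarrow> real \<Rightarrow> real"
  assumes "slice_differentiable f t"
    and "slice_differentiable g t"
  shows "slice_differentiable (\<lambda>x y t. f x y t * g x y t) t"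
  using assms by (simp add: slice_differentiable_def differentiable_on_def case_prod_unfold)

lemma slice_differentiable_add:
  fixes f g :: "real \<Rightarrow> real \<Rightarrow> real \<Rightarrow> real"
  assumes "slice_differentiable f t"
    and "slice_differentiable g t"
  shows "slice_differentiable (\<lambda>x y t. f x y t + g x y t) t"
  using assms by (simp add: slice_differentiable_def differentiable_on_def case_prod_unfold)

lemma pderiv_space_mult:
  fixes f g :: "real \<Rightarrow> real \<Rightarrow> real \<Rightarrow> real"
  assumes f: "slice_differentiable f t"
    and g: "slice_differentiable g t" and "0 \<le> b"
  shows "pderiv_space i (\<lambda>x y t. f x y t * g x y t) a b t
    = f a b t * pderiv_space i g a b t + pderiv_space i f a b t * g a b t"
proof -
  note F = slice_differentiable_slices[of f t b a, OF f \<open>0 \<le> b\<close>]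
  note G = slice_differentiable_slices[of g t b a, OF g \<open>0 \<le> b\<close>]
  have "pderiv_space 1 (\<lambda>x y t. f x y t * g x y t) a b t
      = f a b t * pderiv_space 1 g a b t + pderiv_space 1 f a b t * g a b t"
    by (rule pderiv_space_1_eq) (rule has_vector_derivative_mult[OF F(1) G(1)])
  moreover have "pderiv_space 2 (\<lambda>x y t. f x y t * g x y t) a b t
      = f a b t * pderiv_space 2 g a b t + pderiv_space 2 f a b t * g a b t"
    by (rule pderiv_space_2_eq[OF _ \<open>0 \<le> b\<close>]) (rule has_vector_derivative_mult[OF F(2) G(2)])
  ultimately show ?thesis
    using exhaust_2[of i] by auto
qed

lemma pderiv_space_add:
  fixes f g :: "real \<Rightarrow> real \<Rightarrow> real \<Rightarrow> real"
  assumes f: "slice_differentiable f t"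
    and g: "slice_differentiable g t" and "0 \<le> b"
  shows "pderiv_space i (\<lambda>x y t. f x y t + g x y t) a b t
    = pderiv_space i f a b t + pderiv_space i g a b t"
proof -
  note F = slice_differentiable_slices[of f t b a, OF f \<open>0 \<le> b\<close>]
  note G = slice_differentiable_slices[of g t b a, OF g \<open>0 \<le> b\<close>]
  have "pderiv_space 1 (\<lambda>x y t. f x y t + g x y t) a b t
      = pderiv_space 1 f a b t + pderiv_space 1 g a b t"
    by (rule pderiv_space_1_eq) (rule has_vector_derivative_add[OF F(1) G(1)])
  moreover have "pderiv_space 2 (\<lambda>x y t. f x y t + g x y t) a b t
      = pderiv_space 2 f a b t + pderiv_space 2 g a b t"
    by (rule pderiv_space_2_eq[OF _ \<open>0 \<le> b\<close>]) (rule has_vector_derivative_add[OF F(2) G(2)])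
  ultimately show ?thesis
    using exhaust_2[of i] by auto
qed

text \<open>Identities such as det F = 1 hold on the half plane only; one-sided derivatives do not
  see the values below it.\<close>

lemma pderiv_space_cong:
  assumes "\<And>x y. 0 \<le> y \<Longrightarrow> f x y t = g x y t" "0 \<le> b"
    and g: "slice_differentiable g t"
  shows "pderiv_space i f a b t = pderiv_space i g a b t"
proof -
  note G = slice_differentiable_slices[of g t b a, OF g \<open>0 \<le> b\<close>]
  have "pderiv_space 1 f a b t = pderiv_space 1 g a b t"
    by (rule pderiv_space_1_eq) (use G(1) assms in simp)
  moreover have "pderiv_space 2 f a b t = pderiv_space 2 g a b t"
    by (rule pderiv_space_2_eq[OF has_vector_derivative_transform[OF _ _ G(2)]]) (use assms in auto)
  ultimately show ?thesis
    using exhaust_2[of i] by auto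
qed

lemma slice_differentiable_vec_nth:
  assumes "slice_differentiable C t"
  shows "slice_differentiable (\<lambda>x y t. C x y t $ i) t"
  using assms bounded_linear.has_derivative[OF bounded_linear_vec_nth, of "\<lambda>p. C (fst p) (snd p) t"]
  unfolding slice_differentiable_def differentiable_on_def differentiable_def case_prod_unfold by blast

text \<open>With r = \<eta> . A \<eta> nonnegative, the symbol factors over the reals with roots
  sqrt r and - sqrt r, which coincide when r = 0.\<close>

lemma hyperbolic_in_time_if_psd:
  assumes "\<And>z. 0 \<le> z \<bullet> (A *v z)"
  shows "hyperbolic_in_time A"
  unfolding hyperbolic_in_time_def
proof (intro allI impI)
  fix \<eta> :: "real^2" and \<tau> :: complex
  define r where "r = \<eta> \<bullet> (A *v \<eta>)"
  assume "\<tau>\<^sup>2 - complex_of_real (\<eta> \<bullet> (A *v \<eta>)) = 0"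
  then have "\<tau>\<^sup>2 = complex_of_real (sqrt r) ^ 2"
    using assms[of \<eta>] by (simp add: r_def flip: of_real_power)
  then have "\<tau> = complex_of_real (sqrt r) \<or> \<tau> = - complex_of_real (sqrt r)"
    by (rule power2_eq_iff[THEN iffD1])
  then show "\<tau> \<in> \<real>"
    by auto
qed

subsection \<open>The flow map\<close>

text \<open>Only the kinematics is fixed here. Incompressibility and the no-slip condition are
  premises of the individual lemmas that rest on them.\<close>

locale smooth_flow =
  fixes T :: real and u v X Y :: "real \<Rightarrow> real \<Rightarrow> real \<Rightarrow> real"
  assumes smooth_u: "smooth_on (domain T) (\<lambda>(x, y, t). u x y t)"
    and smooth_v: "smooth_on (domain T) (\<lambda>(x, y, t). v x y t)"
    and smooth_X: "smooth_on (domain T) (\<lambda>(\<xi>1, \<xi>2, t). X \<xi>1 \<xi>2 t)"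
    and smooth_Y: "smooth_on (domain T) (\<lambda>(\<xi>1, \<xi>2, t). Y \<xi>1 \<xi>2 t)"
    and flow: "is_flow_map T u v X Y"
begin

lemma flow_ode:
  assumes "(a, b, t) \<in> domain T"
  shows "((\<lambda>s. X a b s) has_real_derivative u (X a b t) (Y a b t) t) (at t within {0..<T})"
    and "((\<lambda>s. Y a b s) has_real_derivative v (X a b t) (Y a b t) t) (at t within {0..<T})"
  using bspec[OF conjunct1[OF flow[unfolded is_flow_map_def]] assms] by simp_all

lemma flow_initial:
  assumes "0 \<le> b"
  shows "X a b 0 = a" and "Y a b 0 = b"
  using bspec[OF conjunct1[OF conjunct2[OF flow[unfolded is_flow_map_def]]], of "(a, b)"] assms
  by simp_all

lemma flow_diffeomorphism:
  "t \<in> {0..<T} \<Longrightarrow> diffeomorphism_of half_plane (\<lambda>(\<xi>1, \<xi>2). (X \<xi>1 \<xi>2 t, Y \<xi>1 \<xi>2 t))"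
  by (rule bspec[OF conjunct2[OF conjunct2[OF flow[unfolded is_flow_map_def]]]])

lemma flow_mem_half_plane:
  assumes "(a, b, t) \<in> domain T"
  shows "0 \<le> Y a b t"
proof -
  have "bij_betw (\<lambda>(\<xi>1, \<xi>2). (X \<xi>1 \<xi>2 t, Y \<xi>1 \<xi>2 t)) half_plane half_plane"
    using flow_diffeomorphism[of t] assms by (simp add: diffeomorphism_of_def)
  from bij_betw_apply[OF this, of "(a, b)"] show ?thesis
    using assms by simp
qed

lemma pderiv_time_flow:
  assumes "(a, b, t) \<in> domain T"
  shows "pderiv_time T X a b t = u (X a b t) (Y a b t) t"
    and "pderiv_time T Y a b t = v (X a b t) (Y a b t) t"
  using flow_ode[OF assms] assms
  by (simp_all add: pderiv_time_eq has_real_derivative_iff_has_vector_derivative)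

text \<open>This is the material derivative: it turns the left-hand sides of the transport and
  momentum equations into time derivatives at a fixed label.\<close>

lemma has_vector_derivative_along_flow:
  assumes "smooth_on (domain T) (\<lambda>(x, y, t). f x y t)" and "(a, b, t) \<in> domain T"
  shows "((\<lambda>s. f (X a b s) (Y a b s) s) has_vector_derivative
    (u (X a b t) (Y a b t) t *\<^sub>R pderiv_space 1 f (X a b t) (Y a b t) t
      + v (X a b t) (Y a b t) t *\<^sub>R pderiv_space 2 f (X a b t) (Y a b t) t
      + pderiv_time T f (X a b t) (Y a b t) t)) (at t within {0..<T})"
  using has_vector_derivative_along_path[where f = f and \<tau> = "\<lambda>s. s" and \<tau>' = 1,
      OF assms(1) flow_ode[OF assms(2)]]
    assms(2) flow_mem_half_plane by simp

text \<open>The function g is kept apart from the composition because it will be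
  \<open>pderiv_time T X\<close> or \<open>pderiv_time T Y\<close>, which agrees with the velocity
  along the flow only for labels in the half plane.\<close>

lemma pderiv_space_compose_flow:
  assumes f: "smooth_on (domain T) (\<lambda>(x, y, t). f x y t)" and p: "(a, b, t) \<in> domain T"
    and g: "\<And>a b. 0 \<le> b \<Longrightarrow> g a b t = f (X a b t) (Y a b t) t"
  shows "pderiv_space i g a b t = pderiv_space i X a b t *\<^sub>R pderiv_space 1 f (X a b t) (Y a b t) t
    + pderiv_space i Y a b t *\<^sub>R pderiv_space 2 f (X a b t) (Y a b t) t"
proof -
  note slices = smooth_on_slices[where ?'a = real, folded has_real_derivative_iff_has_vector_derivative]
  have "((\<lambda>s. f (X s b t) (Y s b t) t) has_vector_derivative
      (pderiv_space 1 X a b t *\<^sub>R pderiv_space 1 f (X a b t) (Y a b t) t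
        + pderiv_space 1 Y a b t *\<^sub>R pderiv_space 2 f (X a b t) (Y a b t) t)) (at a)"
    using has_vector_derivative_along_path[where f = f and I = UNIV and \<tau> = "\<lambda>_. t" and \<tau>' = 0,
        OF f slices(1)[OF smooth_X p] slices(1)[OF smooth_Y p]] p flow_mem_half_plane by simp
  then have 1: "pderiv_space 1 g a b t = pderiv_space 1 X a b t *\<^sub>R pderiv_space 1 f (X a b t) (Y a b t) t
    + pderiv_space 1 Y a b t *\<^sub>R pderiv_space 2 f (X a b t) (Y a b t) t"
    using p by (intro pderiv_space_1_eq) (simp add: g)
  have "((\<lambda>s. f (X a s t) (Y a s t) t) has_vector_derivative
      (pderiv_space 2 X a b t *\<^sub>R pderiv_space 1 f (X a b t) (Y a b t) t
        + pderiv_space 2 Y a b t *\<^sub>R pderiv_space 2 f (X a b t) (Y a b t) t)) (at b within {0..})"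
    using has_vector_derivative_along_path[where f = f and I = "{0..}" and \<tau> = "\<lambda>_. t" and \<tau>' = 0,
        OF f slices(2)[OF smooth_X p] slices(2)[OF smooth_Y p]] p flow_mem_half_plane by simp
  then have "((\<lambda>s. g a s t) has_vector_derivative
      (pderiv_space 2 X a b t *\<^sub>R pderiv_space 1 f (X a b t) (Y a b t) t
        + pderiv_space 2 Y a b t *\<^sub>R pderiv_space 2 f (X a b t) (Y a b t) t)) (at b within {0..})"
    by (rule has_vector_derivative_transform[rotated 2]) (use p g in auto)
  then have "pderiv_space 2 g a b t = pderiv_space 2 X a b t *\<^sub>R pderiv_space 1 f (X a b t) (Y a b t) t
    + pderiv_space 2 Y a b t *\<^sub>R pderiv_space 2 f (X a b t) (Y a b t) t"
    using p by (intro pderiv_space_2_eq) simp_all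
  with 1 show ?thesis
    using exhaust_2[of i] by auto
qed

section \<open>Liouville's formula and the determinant of F\<close>

definition jacobian :: "real \<Rightarrow> real \<Rightarrow> real \<Rightarrow> real" where
  "jacobian a b t = pderiv_space 1 X a b t * pderiv_space 2 Y a b t
     - pderiv_space 2 X a b t * pderiv_space 1 Y a b t"

lemma jacobian_initial:
  assumes "(a, b, 0) \<in> domain T"
  shows "jacobian a b 0 = 1"
proof -
  have "pderiv_space 1 X a b 0 = 1" "pderiv_space 1 Y a b 0 = 0"
    using assms by (auto intro!: pderiv_space_1_eq derivative_eq_intros simp: flow_initial)
  \<comment> \<open>The initial condition is known only for labels in the half plane, so the
    derivative is transferred within the half-line.\<close>
  moreover have "((\<lambda>s. X a s 0) has_vector_derivative 0) (at b within {0..})"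
    by (rule has_vector_derivative_transform[where f = "\<lambda>_. a"]) (use assms in \<open>auto simp: flow_initial\<close>)
  then have "pderiv_space 2 X a b 0 = 0"
    using assms by (simp add: pderiv_space_2_eq)
  moreover have "((\<lambda>s. Y a s 0) has_vector_derivative 1) (at b within {0..})"
    by (rule has_vector_derivative_transform[where f = "\<lambda>s. s"]) (use assms in \<open>auto simp: flow_initial\<close>)
  then have "pderiv_space 2 Y a b 0 = 1"
    using assms by (simp add: pderiv_space_2_eq)
  ultimately show ?thesis
    by (simp add: jacobian_def)
qed

text \<open>Exchanging time and label derivatives gives F_t = (grad v) F. The derivative of det F is
  then the trace of grad v, that is the divergence of the velocity, times det F; so det F keeps its
  initial value.\<close>

lemma jacobian_eq_1:
  assumes incompressible: "\<And>x y t. (x, y, t) \<in> domain T \<Longrightarrow>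
      pderiv_space 1 u x y t + pderiv_space 2 v x y t = 0"
    and p: "(a, b, t) \<in> domain T"
  shows "jacobian a b t = 1"
proof -
  have "((\<lambda>s. jacobian a b s) has_vector_derivative 0) (at s within {0..<T})" if "s \<in> {0..<T}" for s
  proof -
    have q: "(a, b, s) \<in> domain T"
      using p that by simp
    let ?x = "X a b s" and ?y = "Y a b s"
    note slice = smooth_on_slices(3)[where ?'a = real, folded has_real_derivative_iff_has_vector_derivative,
        OF smooth_on_pderiv(1) q subset_refl that]
    have DX: "((\<lambda>r. pderiv_space i X a b r) has_real_derivative
        pderiv_space i X a b s * pderiv_space 1 u ?x ?y s
        + pderiv_space i Y a b s * pderiv_space 2 u ?x ?y s) (at s within {0..<T})" for i
    proof -
      have "pderiv_time T (pderiv_space i X) a b s = pderiv_space i (pderiv_time T X) a b s"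
        by (rule pderiv_commute(2)[OF smooth_X q])
      also have "\<dots> = pderiv_space i X a b s *\<^sub>R pderiv_space 1 u ?x ?y s
          + pderiv_space i Y a b s *\<^sub>R pderiv_space 2 u ?x ?y s"
        by (rule pderiv_space_compose_flow[OF smooth_u q]) (use q in \<open>simp add: pderiv_time_flow\<close>)
      finally show ?thesis
        using slice[OF smooth_X, of i] by simp
    qed
    have DY: "((\<lambda>r. pderiv_space i Y a b r) has_real_derivative
        pderiv_space i X a b s * pderiv_space 1 v ?x ?y s
        + pderiv_space i Y a b s * pderiv_space 2 v ?x ?y s) (at s within {0..<T})" for i
    proof -
      have "pderiv_time T (pderiv_space i Y) a b s = pderiv_space i (pderiv_time T Y) a b s"
        by (rule pderiv_commute(2)[OF smooth_Y q])
      also have "\<dots> = pderiv_space i X a b s *\<^sub>R pderiv_space 1 v ?x ?y s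
          + pderiv_space i Y a b s *\<^sub>R pderiv_space 2 v ?x ?y s"
        by (rule pderiv_space_compose_flow[OF smooth_v q]) (use q in \<open>simp add: pderiv_time_flow\<close>)
      finally show ?thesis
        using slice[OF smooth_Y, of i] by simp
    qed
    have "((\<lambda>r. jacobian a b r) has_real_derivative
        (pderiv_space 1 u ?x ?y s + pderiv_space 2 v ?x ?y s) * jacobian a b s) (at s within {0..<T})"
      unfolding jacobian_def
      by (rule derivative_eq_intros DX DY refl)+ (simp add: algebra_simps)
    moreover have "pderiv_space 1 u ?x ?y s + pderiv_space 2 v ?x ?y s = 0"
      using incompressible[of ?x ?y s] flow_mem_half_plane[OF q] q by simp
    ultimately show ?thesis
      by (simp add: has_real_derivative_iff_has_vector_derivative)
  qed
  then obtain c where c: "\<And>s. s \<in> {0..<T} \<Longrightarrow> jacobian a b s = c"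
    using has_vector_derivative_zero_constant[of "{0..<T}" "jacobian a b"] by blast
  from c[of t] c[of 0] show ?thesis
    using p jacobian_initial[of a b] by simp
qed

text \<open>Differentiability of \<open>\<sigma>\<close> comes from that of the inverse flow map.\<close>

lemma pderiv_space_pullback:
  fixes \<alpha> \<sigma> :: "real \<Rightarrow> real \<Rightarrow> real \<Rightarrow> real"
  assumes p: "(a, b, t) \<in> domain T"
    and \<alpha>: "slice_differentiable \<alpha> t"
    and \<sigma>: "\<And>a b. 0 \<le> b \<Longrightarrow> \<sigma> (X a b t) (Y a b t) t = \<alpha> a b t"
  shows "pderiv_space i \<alpha> a b t =
    pderiv_space i X a b t * pderiv_space 1 \<sigma> (X a b t) (Y a b t) t
    + pderiv_space i Y a b t * pderiv_space 2 \<sigma> (X a b t) (Y a b t) t"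
proof -
  define \<Phi> where "\<Phi> = (\<lambda>(\<xi>1, \<xi>2). (X \<xi>1 \<xi>2 t, Y \<xi>1 \<xi>2 t))"
  define \<Psi> where "\<Psi> = inv_into half_plane \<Phi>"
  let ?z = "(X a b t, Y a b t)"
  have bij: "bij_betw \<Phi> half_plane half_plane" and smooth_\<Psi>: "smooth_on half_plane \<Psi>"
    using flow_diffeomorphism[of t] p by (simp_all add: diffeomorphism_of_def \<Phi>_def \<Psi>_def)
  have bij_\<Psi>: "bij_betw \<Psi> half_plane half_plane"
    unfolding \<Psi>_def using bij by (rule bij_betw_inv_into)
  have ab: "(a, b) \<in> half_plane" and z: "?z \<in> half_plane"
    using p flow_mem_half_plane[OF p] by simp_all
  have \<Psi>z: "\<Psi> ?z = (a, b)"
    using bij_betw_inv_into_left[OF bij ab] by (simp add: \<Phi>_def \<Psi>_def)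
  \<comment> \<open>The hypothesis on \<sigma> is inverted: on the whole half plane \<sigma> is
    \<alpha> after \<Psi>, and both factors are differentiable.\<close>
  have eq: "(\<lambda>(x, y). \<sigma> x y t) w = (\<lambda>(a, b). \<alpha> a b t) (\<Psi> w)" if "w \<in> half_plane" for w
  proof -
    obtain c d where cd: "\<Psi> w = (c, d)"
      by fastforce
    have "0 \<le> d"
      using bij_betw_apply[OF bij_\<Psi> that] cd by simp
    moreover have "w = (X c d t, Y c d t)"
      using bij_betw_inv_into_right[OF bij that] cd by (simp add: \<Phi>_def \<Psi>_def)
    ultimately show ?thesis
      using \<sigma> cd by simp
  qed
  obtain \<alpha>' where \<alpha>': "((\<lambda>(a, b). \<alpha> a b t) has_derivative \<alpha>') (at (a, b) within half_plane)"
    using \<alpha> ab unfolding slice_differentiable_def differentiable_on_def differentiable_def by blast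
  define \<Psi>' where "\<Psi>' = frechet_derivative \<Psi> (at ?z within half_plane)"
  have \<Psi>': "(\<Psi> has_derivative \<Psi>') (at ?z within half_plane)"
    using smooth_on_has_derivative[OF smooth_\<Psi> z] by (simp add: \<Psi>'_def)
  have "((\<lambda>w. (\<lambda>(a, b). \<alpha> a b t) (\<Psi> w)) has_derivative (\<lambda>h. \<alpha>' (\<Psi>' h))) (at ?z within half_plane)"
    by (rule has_derivative_in_compose[OF \<Psi>']) (simp add: \<Psi>z bij_betw_imp_surj_on[OF bij_\<Psi>] \<alpha>')
  then have D: "((\<lambda>(x, y). \<sigma> x y t) has_derivative (\<lambda>h. \<alpha>' (\<Psi>' h))) (at ?z within half_plane)"
    by (rule has_derivative_transform[OF z, rotated]) (rule eq)
  define \<sigma>' where "\<sigma>' = (\<lambda>h. \<alpha>' (\<Psi>' h))"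
  note D = D[folded \<sigma>'_def]
  have pd: "pderiv_space 1 \<sigma> (X a b t) (Y a b t) t = \<sigma>' (1, 0)"
    "pderiv_space 2 \<sigma> (X a b t) (Y a b t) t = \<sigma>' (0, 1)"
    using half_plane_pderiv[of \<sigma> t \<sigma>' "X a b t" "Y a b t", OF D] z by simp_all
  have lin: "\<sigma>' (h, k) = h * \<sigma>' (1, 0) + k * \<sigma>' (0, 1)" for h k
  proof -
    note l = has_derivative_linear[OF D]
    have "\<sigma>' (h, k) = \<sigma>' (h *\<^sub>R (1, 0) + k *\<^sub>R (0, 1))"
      by simp
    also have "\<dots> = h *\<^sub>R \<sigma>' (1, 0) + k *\<^sub>R \<sigma>' (0, 1)"
      by (simp only: linear_add[OF l] linear_scale[OF l])
    finally show ?thesis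
      by simp
  qed
  \<comment> \<open>Once \<sigma> is known to be differentiable, the claim is the ordinary chain
    rule along the images of the label lines.\<close>
  have "((\<lambda>s. (\<lambda>(x, y). \<sigma> x y t) (X s b t, Y s b t)) has_vector_derivative
      \<sigma>' (pderiv_space 1 X a b t, pderiv_space 1 Y a b t)) (at a)"
    by (rule has_vector_derivative_along_line[OF D, where \<gamma> = "\<lambda>s. (X s b t, Y s b t)"])
       (use p flow_mem_half_plane smooth_on_slices(1)[OF smooth_X p] smooth_on_slices(1)[OF smooth_Y p]
         in \<open>auto intro: has_vector_derivative_Pair\<close>)
  then have 1: "pderiv_space 1 \<alpha> a b t = \<sigma>' (pderiv_space 1 X a b t, pderiv_space 1 Y a b t)"
    using p \<sigma> by (intro pderiv_space_1_eq) simp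
  have "((\<lambda>s. (\<lambda>(x, y). \<sigma> x y t) (X a s t, Y a s t)) has_vector_derivative
      \<sigma>' (pderiv_space 2 X a b t, pderiv_space 2 Y a b t)) (at b within {0..})"
    by (rule has_vector_derivative_along_line[OF D, where \<gamma> = "\<lambda>s. (X a s t, Y a s t)"])
       (use p flow_mem_half_plane smooth_on_slices(2)[OF smooth_X p] smooth_on_slices(2)[OF smooth_Y p]
         in \<open>auto intro: has_vector_derivative_Pair\<close>)
  then have "((\<lambda>s. \<alpha> a s t) has_vector_derivative
      \<sigma>' (pderiv_space 2 X a b t, pderiv_space 2 Y a b t)) (at b within {0..})"
    by (rule has_vector_derivative_transform[rotated 2]) (use p \<sigma> in auto)
  then have 2: "pderiv_space 2 \<alpha> a b t = \<sigma>' (pderiv_space 2 X a b t, pderiv_space 2 Y a b t)"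
    using p by (intro pderiv_space_2_eq) simp_all
  show ?thesis
    using exhaust_2[of i] 1 2 lin[of "pderiv_space i X a b t" "pderiv_space i Y a b t"] pd by auto
qed

section \<open>Trajectories that start at the wall\<close>

lemma flow_boundary:
  assumes no_slip: "\<And>x t. t \<in> {0..<T} \<Longrightarrow> u x 0 t = 0 \<and> v x 0 t = 0"
    and t: "t \<in> {0..<T}"
  shows "X a 0 t = a" and "Y a 0 t = 0"
proof -
  have dom: "(a, 0, s) \<in> domain T" if "s \<in> {0..t}" for s
    using that t by simp
  have sub: "{0..s} \<subseteq> {0..<T}" if "s \<in> {0..t}" for s
    using that t by auto
  note ode = flow_ode[of a 0, OF dom]
  have cont: "continuous_on {0..t} (\<lambda>s. X a 0 s)" "continuous_on {0..t} (\<lambda>s. Y a 0 s)"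
    by (rule smooth_on_domain_continuous_on_compose[OF smooth_X] smooth_on_domain_continuous_on_compose[OF smooth_Y];
        use t in \<open>auto intro!: continuous_intros\<close>)+
  obtain M where M: "\<forall>s\<in>{0..t}. \<bar>X a 0 s\<bar> \<le> M"
    using compact_imp_bounded[OF compact_continuous_image[OF cont(1)]] by (auto simp: bounded_iff)
  obtain N where N: "\<forall>s\<in>{0..t}. \<bar>Y a 0 s\<bar> \<le> N"
    using compact_imp_bounded[OF compact_continuous_image[OF cont(2)]] by (auto simp: bounded_iff)
  \<comment> \<open>A compact box around the trajectory up to time t. It reaches down to y = 0, so
    it contains the vertical segments from the wall on which the mean value theorem is applied to v;
    L bounds the y-derivative of v on it.\<close>
  define K where "K = {-M..M} \<times> {0..N} \<times> {0..t}"
  have "compact K"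
    unfolding K_def by (intro compact_Times compact_Icc)
  moreover have "continuous_on K (\<lambda>(x, y, t). pderiv_space 2 v x y t)"
    by (rule continuous_on_subset[OF smooth_on_continuous_on[OF smooth_on_pderiv(1)[OF smooth_v]]])
       (use t in \<open>auto simp: K_def\<close>)
  ultimately have "bounded ((\<lambda>(x, y, t). pderiv_space 2 v x y t) ` K)"
    by (intro compact_imp_bounded compact_continuous_image)
  then obtain L where L: "\<forall>p\<in>K. \<bar>(\<lambda>(x, y, t). pderiv_space 2 v x y t) p\<bar> \<le> L"
    by (auto simp: bounded_iff)
  have v_le: "v x y s \<le> L * y" if "(x, y, s) \<in> K" for x y s
  proof (cases "y = 0")
    case True
    then show ?thesis
      using no_slip that t by (simp add: K_def)
  next
    case False
    then have "0 < y"
      using that by (simp add: K_def)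
    moreover have "((\<lambda>r. v x r s) has_real_derivative pderiv_space 2 v x r s) (at r within {0..y})"
      if r: "r \<in> {0..y}" for r
      using smooth_on_slices(2)[OF smooth_v, of x r s "{0..y}"] r t \<open>(x, y, s) \<in> K\<close>
      by (simp add: has_real_derivative_iff_has_vector_derivative K_def)
    ultimately obtain c where c: "0 < c" "c < y" "v x y s - v x 0 s = pderiv_space 2 v x c s * (y - 0)"
      by (rule mvt_real)
    have "pderiv_space 2 v x c s \<le> L"
      using bspec[OF L, of "(x, c, s)"] c(1,2) that by (simp add: K_def)
    then show ?thesis
      using c no_slip[of s x] that t \<open>0 < y\<close> by (simp add: K_def)
  qed
  have Y0: "Y a 0 s = 0" if s: "s \<in> {0..t}" for s
  proof (cases "s = 0")
    case True
    then show ?thesis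
      by (simp add: flow_initial)
  next
    case False
    then have "0 < s"
      using s by simp
    \<comment> \<open>Gronwall with an integrating factor: the product starts at 0 and has
      nonpositive derivative. Together with Y >= 0 this forces Y = 0, so an upper bound for v is
      enough.\<close>
    have "((\<lambda>r. Y a 0 r * exp (- L * r)) has_real_derivative
        (v (X a 0 r) (Y a 0 r) r - L * Y a 0 r) * exp (- L * r)) (at r within {0..s})"
      if r: "r \<in> {0..s}" for r
    proof -
      have "((\<lambda>s. Y a 0 s) has_real_derivative v (X a 0 r) (Y a 0 r) r) (at r within {0..s})"
        using DERIV_subset[OF ode(2) sub[OF s]] r s by simp
      then show ?thesis
        by (auto intro!: derivative_eq_intros simp: algebra_simps)
    qed
    then obtain c where c: "0 < c" "c < s"
      "Y a 0 s * exp (- L * s) - Y a 0 0 * exp (- L * 0)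
        = (v (X a 0 c) (Y a 0 c) c - L * Y a 0 c) * exp (- L * c) * (s - 0)"
      by (rule mvt_real[OF \<open>0 < s\<close>])
    have "c \<in> {0..t}"
      using c s by simp
    then have "(X a 0 c, Y a 0 c, c) \<in> K"
      using bspec[OF M, of c] bspec[OF N, of c] flow_mem_half_plane[OF dom] by (auto simp: K_def)
    then have "(v (X a 0 c) (Y a 0 c) c - L * Y a 0 c) * exp (- L * c) * s \<le> 0"
      using v_le \<open>0 < s\<close> by (intro mult_nonpos_nonneg) auto
    then have "Y a 0 s * exp (- L * s) \<le> 0"
      using c(3) by (simp add: flow_initial)
    then have "Y a 0 s \<le> 0"
      by (simp add: mult_le_0_iff)
    then show ?thesis
      using flow_mem_half_plane[OF dom[OF s]] by simp
  qed
  then show "Y a 0 t = 0"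
    using t by simp
  have "((\<lambda>s. X a 0 s) has_vector_derivative 0) (at s within {0..t})" if s: "s \<in> {0..t}" for s
    using DERIV_subset[OF ode(1)[OF s] sub[of t]] s t Y0[OF s] no_slip[of s]
    by (simp add: has_real_derivative_iff_has_vector_derivative)
  then obtain c where c: "\<And>s. s \<in> {0..t} \<Longrightarrow> X a 0 s = c"
    using has_vector_derivative_zero_constant[of "{0..t}" "X a 0"] by blast
  from c[of 0] c[of t] show "X a 0 t = a"
    using t by (simp add: flow_initial)
qed

section \<open>The Piola identity for the divergence\<close>

text \<open>Spatial differentiation of det F = 1, arranged as F11 F22 = 1 + F12 F21 so that the sum
  and product rules suffice.\<close>

lemma jacobian_derivative:
  assumes incompressible: "\<And>x y t. (x, y, t) \<in> domain T \<Longrightarrow>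
      pderiv_space 1 u x y t + pderiv_space 2 v x y t = 0"
    and p: "(a, b, t) \<in> domain T"
  shows "pderiv_space 1 X a b t * pderiv_space i (pderiv_space 2 Y) a b t
      + pderiv_space i (pderiv_space 1 X) a b t * pderiv_space 2 Y a b t
    = pderiv_space 2 X a b t * pderiv_space i (pderiv_space 1 Y) a b t
      + pderiv_space i (pderiv_space 2 X) a b t * pderiv_space 1 Y a b t"
proof -
  have t: "0 \<le> t" "t < T" and b: "0 \<le> b"
    using p by simp_all
  note diff = smooth_on_domain_slice_differentiable[OF smooth_on_pderiv(1)[OF smooth_X] t]
    smooth_on_domain_slice_differentiable[OF smooth_on_pderiv(1)[OF smooth_Y] t]
  have one: "slice_differentiable (\<lambda>x y t. 1::real) t"
    by (simp add: slice_differentiable_def case_prod_unfold)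
  have "pderiv_space 1 X a b t * pderiv_space i (pderiv_space 2 Y) a b t
      + pderiv_space i (pderiv_space 1 X) a b t * pderiv_space 2 Y a b t
    = pderiv_space i (\<lambda>x y t. pderiv_space 1 X x y t * pderiv_space 2 Y x y t) a b t"
    by (rule pderiv_space_mult[OF diff b, symmetric])
  also have "\<dots> = pderiv_space i (\<lambda>x y t. 1 + pderiv_space 2 X x y t * pderiv_space 1 Y x y t) a b t"
  proof (rule pderiv_space_cong[OF _ b])
    show "pderiv_space 1 X x y t * pderiv_space 2 Y x y t
        = 1 + pderiv_space 2 X x y t * pderiv_space 1 Y x y t" if "0 \<le> y" for x y
      using jacobian_eq_1[OF incompressible, of x y t] t that by (simp add: jacobian_def)
  qed (intro slice_differentiable_add slice_differentiable_mult diff one)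
  also have "\<dots> = pderiv_space i (\<lambda>x y t. 1) a b t
      + pderiv_space i (\<lambda>x y t. pderiv_space 2 X x y t * pderiv_space 1 Y x y t) a b t"
    by (rule pderiv_space_add[OF one slice_differentiable_mult[OF diff] b])
  also have "pderiv_space i (\<lambda>x y t. 1::real) a b t = 0"
    using exhaust_2[of i] b by (auto intro!: pderiv_space_1_eq pderiv_space_2_eq)
  also have "pderiv_space i (\<lambda>x y t. pderiv_space 2 X x y t * pderiv_space 1 Y x y t) a b t
    = pderiv_space 2 X a b t * pderiv_space i (pderiv_space 1 Y) a b t
      + pderiv_space i (pderiv_space 2 X) a b t * pderiv_space 1 Y a b t"
    by (rule pderiv_space_mult[OF diff b])
  finally show ?thesis
    by simp
qed

text \<open>Since \<open>det F = 1\<close>, the field \<open>(G\<^sub>1, G\<^sub>2) = F\<^sup>-\<^sup>1 (\<sigma>, \<tau>)\<close> is the Piola transform of \<open>(\<sigma>, \<tau>)\<close>.\<close>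

lemma piola:
  fixes G1 G2 \<sigma> \<tau> :: "real \<Rightarrow> real \<Rightarrow> real \<Rightarrow> real"
  assumes incompressible: "\<And>x y t. (x, y, t) \<in> domain T \<Longrightarrow>
      pderiv_space 1 u x y t + pderiv_space 2 v x y t = 0"
    and p: "(a, b, t) \<in> domain T"
    and G: "slice_differentiable G1 t"
      "slice_differentiable G2 t"
    and \<sigma>: "\<And>a b. 0 \<le> b \<Longrightarrow> \<sigma> (X a b t) (Y a b t) t
      = pderiv_space 1 X a b t * G1 a b t + pderiv_space 2 X a b t * G2 a b t"
    and \<tau>: "\<And>a b. 0 \<le> b \<Longrightarrow> \<tau> (X a b t) (Y a b t) t
      = pderiv_space 1 Y a b t * G1 a b t + pderiv_space 2 Y a b t * G2 a b t"
  shows "pderiv_space 1 \<sigma> (X a b t) (Y a b t) t + pderiv_space 2 \<tau> (X a b t) (Y a b t) t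
    = pderiv_space 1 G1 a b t + pderiv_space 2 G2 a b t"
proof -
  have t: "0 \<le> t" "t < T" and b: "0 \<le> b"
    using p by simp_all
  note diff = smooth_on_domain_slice_differentiable[OF smooth_on_pderiv(1)[OF smooth_X] t]
    smooth_on_domain_slice_differentiable[OF smooth_on_pderiv(1)[OF smooth_Y] t]
  note prod = slice_differentiable_mult[OF diff(1) G(1)] slice_differentiable_mult[OF diff(1) G(2)]
    slice_differentiable_mult[OF diff(2) G(1)] slice_differentiable_mult[OF diff(2) G(2)]
  let ?X = "\<lambda>i. pderiv_space i X a b t" and ?Y = "\<lambda>i. pderiv_space i Y a b t"
  let ?XX = "\<lambda>i j. pderiv_space i (pderiv_space j X) a b t"
  let ?YY = "\<lambda>i j. pderiv_space i (pderiv_space j Y) a b t"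
  define g1 g2 where "g1 = G1 a b t" and "g2 = G2 a b t"
  define d1 d2 where "d1 i = pderiv_space i G1 a b t" and "d2 i = pderiv_space i G2 a b t" for i
  define sx sy where "sx = pderiv_space 1 \<sigma> (X a b t) (Y a b t) t"
    and "sy = pderiv_space 2 \<sigma> (X a b t) (Y a b t) t"
  define tx ty where "tx = pderiv_space 1 \<tau> (X a b t) (Y a b t) t"
    and "ty = pderiv_space 2 \<tau> (X a b t) (Y a b t) t"
  \<comment> \<open>Two expressions for the label derivatives of \<sigma> along the flow: the chain
    rule on the left, the product rule on the right. For i = 1, 2 this is a linear system for sx and
    sy.\<close>
  have S: "?X i * sx + ?Y i * sy = (?X 1 * d1 i + ?XX i 1 * g1) + (?X 2 * d2 i + ?XX i 2 * g2)" for i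
  proof -
    have "?X i * sx + ?Y i * sy = pderiv_space i (\<lambda>a b t. pderiv_space 1 X a b t * G1 a b t
        + pderiv_space 2 X a b t * G2 a b t) a b t"
      unfolding sx_def sy_def
      by (rule pderiv_space_pullback[OF p, symmetric])
         (rule slice_differentiable_add[OF prod(1,2)], rule \<sigma>)
    also have "\<dots> = (?X 1 * d1 i + ?XX i 1 * g1) + (?X 2 * d2 i + ?XX i 2 * g2)"
      by (simp only: pderiv_space_add[OF prod(1,2) b] pderiv_space_mult[OF diff(1) G(1) b]
          pderiv_space_mult[OF diff(1) G(2) b] g1_def g2_def d1_def d2_def)
    finally show ?thesis .
  qed
  have R: "?X i * tx + ?Y i * ty = (?Y 1 * d1 i + ?YY i 1 * g1) + (?Y 2 * d2 i + ?YY i 2 * g2)" for i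
  proof -
    have "?X i * tx + ?Y i * ty = pderiv_space i (\<lambda>a b t. pderiv_space 1 Y a b t * G1 a b t
        + pderiv_space 2 Y a b t * G2 a b t) a b t"
      unfolding tx_def ty_def
      by (rule pderiv_space_pullback[OF p, symmetric])
         (rule slice_differentiable_add[OF prod(3,4)], rule \<tau>)
    also have "\<dots> = (?Y 1 * d1 i + ?YY i 1 * g1) + (?Y 2 * d2 i + ?YY i 2 * g2)"
      by (simp only: pderiv_space_add[OF prod(3,4) b] pderiv_space_mult[OF diff(2) G(1) b]
          pderiv_space_mult[OF diff(2) G(2) b] g1_def g2_def d1_def d2_def)
    finally show ?thesis .
  qed
  have J: "?X 1 * ?Y 2 - ?X 2 * ?Y 1 = 1"
    using jacobian_eq_1[OF incompressible p] by (simp add: jacobian_def)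
  have J': "?X 1 * ?YY i 2 + ?XX i 1 * ?Y 2 - (?X 2 * ?YY i 1 + ?XX i 2 * ?Y 1) = 0" for i
    using jacobian_derivative[OF incompressible p, of i] by simp
  \<comment> \<open>Cramer's rule: multiplying by det F = 1 solves the two systems for sx and
    ty.\<close>
  have "sx + ty = (?X 1 * ?Y 2 - ?X 2 * ?Y 1) * (sx + ty)"
    by (simp add: J)
  also have "\<dots> = ?Y 2 * (?X 1 * sx + ?Y 1 * sy) - ?Y 1 * (?X 2 * sx + ?Y 2 * sy)
      + (?X 1 * (?X 2 * tx + ?Y 2 * ty) - ?X 2 * (?X 1 * tx + ?Y 1 * ty))"
    by (simp add: algebra_simps)
  \<comment> \<open>The factors of g1 and g2 are the derivatives of det F in directions 1 and 2, up
    to the order of mixed partials, and therefore vanish.\<close>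
  also have "\<dots> = (?X 1 * ?Y 2 - ?X 2 * ?Y 1) * (d1 1 + d2 2)
      + g1 * (?X 1 * ?YY 2 1 + ?XX 1 1 * ?Y 2 - (?X 2 * ?YY 1 1 + ?XX 2 1 * ?Y 1))
      + g2 * (?X 1 * ?YY 2 2 + ?XX 1 2 * ?Y 2 - (?X 2 * ?YY 1 2 + ?XX 2 2 * ?Y 1))"
    unfolding S R by (simp add: algebra_simps)
  also have "\<dots> = d1 1 + d2 2"
    using J'[of 1] J'[of 2] by (simp add: J pderiv_commute(1)[OF smooth_X p] pderiv_commute(1)[OF smooth_Y p])
  finally show ?thesis
    by (simp add: sx_def ty_def d1_def d2_def)
qed

lemma eulerian_stress_flow:
  assumes "(a, b, t) \<in> domain T"
  shows "eulerian_stress X Y C (X a b t) (Y a b t) t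
    = deformation_gradient X Y a b t ** C (X a b t) (Y a b t) t ** transpose (deformation_gradient X Y a b t)"
proof -
  let ?\<Phi> = "\<lambda>(\<xi>1, \<xi>2). (X \<xi>1 \<xi>2 t, Y \<xi>1 \<xi>2 t)"
  have bij: "bij_betw ?\<Phi> half_plane half_plane"
    using flow_diffeomorphism[of t] assms by (simp add: diffeomorphism_of_def)
  have "inv_into half_plane ?\<Phi> (X a b t, Y a b t) = (a, b)"
    using bij_betw_inv_into_left[OF bij, of "(a, b)"] assms by simp
  then show ?thesis
    by (simp add: eulerian_stress_def Let_def)
qed

end

theorem lemma1:
  fixes T C0 :: real
    and u v :: "real \<Rightarrow> real \<Rightarrow> real \<Rightarrow> real"
    and C :: "real \<Rightarrow> real \<Rightarrow> real \<Rightarrow> real^2^2"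
    and P :: "real \<Rightarrow> real \<Rightarrow> real"
    and u0 :: "real \<Rightarrow> real \<Rightarrow> real"
    and S0 :: "real \<Rightarrow> real \<Rightarrow> real^2^2"
    and X Y :: "real \<Rightarrow> real \<Rightarrow> real \<Rightarrow> real"
    and S :: "real \<Rightarrow> real \<Rightarrow> real \<Rightarrow> real^2^2"
  assumes T_pos: "0 < T"
    and smooth_u: "smooth_on (domain T) (\<lambda>(x, y, t). u x y t)"
    and smooth_v: "smooth_on (domain T) (\<lambda>(x, y, t). v x y t)"
    and smooth_C: "smooth_on (domain T) (\<lambda>(x, y, t). C x y t)"
    and sym_C: "\<forall>(x, y, t) \<in> domain T. transpose (C x y t) = C x y t"
    and smooth_X: "smooth_on (domain T) (\<lambda>(\<xi>1, \<xi>2, t). X \<xi>1 \<xi>2 t)"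
    and smooth_Y: "smooth_on (domain T) (\<lambda>(\<xi>1, \<xi>2, t). Y \<xi>1 \<xi>2 t)"
    and flow: "is_flow_map T u v X Y"
    and stress: "S = eulerian_stress X Y C"
    and momentum: "\<forall>(x, y, t) \<in> domain T.
      pderiv_time T u x y t + u x y t * pderiv_space 1 u x y t + v x y t * pderiv_space 2 u x y t
      = pderiv_space 1 (\<lambda>x y t. S x y t $ 1 $ 1) x y t
        + pderiv_space 2 (\<lambda>x y t. S x y t $ 1 $ 2) x y t - P x t"
    and transport_C: "\<forall>(x, y, t) \<in> domain T.
      pderiv_time T C x y t + u x y t *\<^sub>R pderiv_space 1 C x y t
        + v x y t *\<^sub>R pderiv_space 2 C x y t = 0"
    and incompressible: "\<forall>(x, y, t) \<in> domain T.
      pderiv_space 1 u x y t + pderiv_space 2 v x y t = 0"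
    and no_slip: "\<forall>x. \<forall>t \<in> {0..<T}. u x 0 t = 0 \<and> v x 0 t = 0"
    and init_u: "\<forall>(x, y) \<in> half_plane. u x y 0 = u0 x y"
    and init_C: "\<forall>(x, y) \<in> half_plane. C x y 0 = S0 x y"
    and psd_C: "\<forall>(x, y, t) \<in> domain T. \<forall>z. 0 \<le> z \<bullet> (C x y t *v z)"
    and C0_pos: "0 < C0"
    and C22: "\<forall>(x, y, t) \<in> domain T. C0 \<le> C x y t $ 2 $ 2"
  shows "\<exists>CL :: real \<Rightarrow> real \<Rightarrow> real^2^2.
    (\<forall>(\<xi>1, \<xi>2, t) \<in> domain T. C (X \<xi>1 \<xi>2 t) (Y \<xi>1 \<xi>2 t) t = CL \<xi>1 \<xi>2) \<and>
    (\<forall>(\<xi>1, \<xi>2, t) \<in> domain T.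
      pderiv_time T (pderiv_time T X) \<xi>1 \<xi>2 t = div_grad CL X \<xi>1 \<xi>2 t - P (X \<xi>1 \<xi>2 t) t) \<and>
    (\<forall>(\<xi>1, \<xi>2) \<in> half_plane. hyperbolic_in_time (CL \<xi>1 \<xi>2)) \<and>
    (\<forall>(\<xi>1, \<xi>2) \<in> half_plane. X \<xi>1 \<xi>2 0 = \<xi>1) \<and>
    (\<forall>(\<xi>1, \<xi>2) \<in> half_plane. pderiv_time T X \<xi>1 \<xi>2 0 = u0 \<xi>1 \<xi>2) \<and>
    (\<forall>\<xi>1. \<forall>t \<in> {0..<T}. X \<xi>1 0 t = \<xi>1)"
proof -
  interpret smooth_flow T u v X Y
    by standard (fact smooth_u smooth_v smooth_X smooth_Y flow)+
  \<comment> \<open>At time 0 the flow is the identity, so the value of C carried along a trajectory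
    is its initial value at the label.\<close>
  define CL where "CL = (\<lambda>a b. C a b 0)"
  have CL: "C (X a b t) (Y a b t) t = CL a b" if p: "(a, b, t) \<in> domain T" for a b t
  proof -
    have "((\<lambda>s. C (X a b s) (Y a b s) s) has_vector_derivative 0) (at s within {0..<T})"
      if s: "s \<in> {0..<T}" for s
    proof -
      have q: "(a, b, s) \<in> domain T"
        using p s by simp
      have "(X a b s, Y a b s, s) \<in> domain T"
        using q flow_mem_half_plane[OF q] by simp
      from bspec[OF transport_C this] show ?thesis
        using has_vector_derivative_along_flow[of C, OF smooth_C q]
        by (simp add: add.commute add.left_commute)
    qed
    then obtain M where M: "\<And>s. s \<in> {0..<T} \<Longrightarrow> C (X a b s) (Y a b s) s = M"
      using has_vector_derivative_zero_constant[of "{0..<T}" "\<lambda>s. C (X a b s) (Y a b s) s"] by blast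
    from M[of t] M[of 0] show ?thesis
      using p by (simp add: CL_def flow_initial)
  qed
  have incomp: "pderiv_space 1 u x y t + pderiv_space 2 v x y t = 0" if "(x, y, t) \<in> domain T" for x y t
    using bspec[OF incompressible that] by simp
  have wave: "pderiv_time T (pderiv_time T X) a b t = div_grad CL X a b t - P (X a b t) t"
    if p: "(a, b, t) \<in> domain T" for a b t
  proof -
    let ?x = "X a b t" and ?y = "Y a b t"
    have t: "0 \<le> t" "t < T" and b: "0 \<le> b"
      using p by simp_all
    have E: "(?x, ?y, t) \<in> domain T"
      using p flow_mem_half_plane[OF p] by simp
    \<comment> \<open>\<open>H i j\<close> is a single summand under the outer derivative in
      \<open>div_grad\<close>; \<open>G i\<close> is the i-th component of C grad x, with the index
      order C_ji.\<close>
    define H where "H i j = (\<lambda>a b s. CL a b $ j $ i * pderiv_space j X a b s)" for i j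
    define G where "G i = (\<lambda>a b s. H i 1 a b s + H i 2 a b s)" for i
    have "slice_differentiable (\<lambda>x y s. CL x y) t"
      using smooth_on_domain_slice_differentiable[of T C 0, OF smooth_C] T_pos
      by (simp add: slice_differentiable_def CL_def)
    then have H: "slice_differentiable (H i j) t" for i j
      unfolding H_def
      by (intro slice_differentiable_mult slice_differentiable_vec_nth
          smooth_on_domain_slice_differentiable[OF smooth_on_pderiv(1)[OF smooth_X] t])
    have G: "slice_differentiable (G i) t" for i
      unfolding G_def by (intro slice_differentiable_add H)
    \<comment> \<open>S_1k is the sum over l, m of F_1l C_lm F_km. Summing over l first leaves F_km
      times the m-th component of C grad x, because F_1l is the l-th derivative of x.\<close>
    have stress_entries:
      "S (X a b t) (Y a b t) t $ 1 $ 1 = pderiv_space 1 X a b t * G 1 a b t + pderiv_space 2 X a b t * G 2 a b t"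
      "S (X a b t) (Y a b t) t $ 1 $ 2 = pderiv_space 1 Y a b t * G 1 a b t + pderiv_space 2 Y a b t * G 2 a b t"
      if "0 \<le> b" for a b
    proof -
      have q: "(a, b, t) \<in> domain T"
        using that t by simp
      show "S (X a b t) (Y a b t) t $ 1 $ 1 = pderiv_space 1 X a b t * G 1 a b t + pderiv_space 2 X a b t * G 2 a b t"
        and "S (X a b t) (Y a b t) t $ 1 $ 2 = pderiv_space 1 Y a b t * G 1 a b t + pderiv_space 2 Y a b t * G 2 a b t"
        unfolding stress eulerian_stress_flow[OF q] CL[OF q]
        by (simp_all add: matrix_matrix_mult_def transpose_def deformation_gradient_def sum_2
            G_def H_def algebra_simps)
    qed
    have "((\<lambda>s. u (X a b s) (Y a b s) s) has_vector_derivative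
        (u ?x ?y t * pderiv_space 1 u ?x ?y t + v ?x ?y t * pderiv_space 2 u ?x ?y t
          + pderiv_time T u ?x ?y t)) (at t within {0..<T})"
      using has_vector_derivative_along_flow[of u, OF smooth_u p] by simp
    then have "((\<lambda>s. pderiv_time T X a b s) has_vector_derivative
        (u ?x ?y t * pderiv_space 1 u ?x ?y t + v ?x ?y t * pderiv_space 2 u ?x ?y t
          + pderiv_time T u ?x ?y t)) (at t within {0..<T})"
      \<comment> \<open>The flow equation identifies x_t with u along the trajectory on all of [0,
        T), so the derivative carries over at t = 0 as well.\<close>
      by (rule has_vector_derivative_transform[rotated 2]) (use t b in \<open>simp_all add: pderiv_time_flow\<close>)
    then have "pderiv_time T (pderiv_time T X) a b t
        = u ?x ?y t * pderiv_space 1 u ?x ?y t + v ?x ?y t * pderiv_space 2 u ?x ?y t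
          + pderiv_time T u ?x ?y t"
      using t by (intro pderiv_time_eq)
    also have "\<dots> = pderiv_space 1 (\<lambda>x y t. S x y t $ 1 $ 1) ?x ?y t
        + pderiv_space 2 (\<lambda>x y t. S x y t $ 1 $ 2) ?x ?y t - P ?x t"
      using bspec[OF momentum E] by simp
    also have "pderiv_space 1 (\<lambda>x y t. S x y t $ 1 $ 1) ?x ?y t
        + pderiv_space 2 (\<lambda>x y t. S x y t $ 1 $ 2) ?x ?y t
      = pderiv_space 1 (G 1) a b t + pderiv_space 2 (G 2) a b t"
      by (rule piola[OF incomp p G G]) (simp_all add: stress_entries)
    also have "\<dots> = div_grad CL X a b t"
      unfolding G_def pderiv_space_add[OF H H b]
      by (simp add: div_grad_def sum_2 H_def)
    finally show ?thesis .
  qed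
  \<comment> \<open>\<open>CL\<close> is C at time 0, which lies in the domain since T > 0;
    semidefiniteness is read off there.\<close>
  have hyp: "hyperbolic_in_time (CL a b)" if "0 \<le> b" for a b
    using bspec[OF psd_C, of "(a, b, 0)"] T_pos that
    by (intro hyperbolic_in_time_if_psd) (simp add: CL_def)
  have velocity: "pderiv_time T X a b 0 = u0 a b" if "0 \<le> b" for a b
    using pderiv_time_flow(1)[of a b 0] bspec[OF init_u, of "(a, b)"] T_pos that
    by (simp add: flow_initial)
  show ?thesis
    using CL wave hyp velocity flow_initial flow_boundary(1)[OF bspec[OF spec[OF no_slip]]]
    by (intro exI[of _ CL]) auto
qed

end
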